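(* Let $G=(V,E)$ be an undirected graph with positive edge weights $c:E\to\mathbb{R}_{+}$, let $t\ge 1$, and let $T_\ell\subseteq T_{\ell-1}\subseteq\cdots\subseteq T_1\subseteq V$ be nested terminal sets. Let $H$ be a minimum-cost subsetwise $(T_1\times T_1)$-spanner of $G$ with stretch factor $t$. The oracle bottom-up algorithm outputs $G_1=H$ and subgraphs $G_\ell\subseteq G_{\ell-1}\subseteq\cdots\subseteq G_2\subseteq H$, obtained from $H$ either by copying $H$ to every level ($G_i=H$ for all $i$) or by pruning edges of $H$ not needed on higher levels, in such a way that each $G_i$ is a subsetwise $(T_i\times T_i)$-spanner of $G$ with stretch factor $t$. Let $\mathrm{BOT}=\sum_{i=1}^{\ell}\sum_{e\in E(G_i)}c_e$ be the cost of this output and let $\mathrm{OPT}$ be the cost of an optimal solution of the multi-level graph spanner problem on this instance. Then $\mathrm{BOT}\le \ell\cdot\mathrm{OPT}$.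
   Context: For a weighted graph $G$, $d_G(u,v)$ denotes the length of a shortest $u$–$v$ path in $G$ with respect to $c$. Given $S\subseteq V$ and $t\ge1$, a subgraph $H$ of $G$ is a subsetwise $(S\times S)$-spanner of $G$ with stretch factor $t$ if $d_H(u,v)\le t\cdot d_G(u,v)$ for all $u,v\in S$; its cost is the sum of the weights of its edges. The multi-level graph spanner (MLGS) problem: given $G$, $c$, nested terminals $T_\ell\subseteq\cdots\subseteq T_1\subseteq V$ and $t\ge1$, find subgraphs $G_\ell\subseteq G_{\ell-1}\subseteq\cdots\subseteq G_1$ of $G$ such that each $G_i$ is a subsetwise $(T_i\times T_i)$-spanner of $G$ with stretch factor $t$, minimizing the cost $\sum_{i=1}^{\ell}\sum_{e\in E(G_i)}c_e$. *)

theory Defs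
  imports "HOL-Library.Extended_Real"
begin

record 'a ugraph =
  verts :: "'a set"
  edges :: "'a set set"

definition finite_graph :: "'a ugraph \<Rightarrow> bool" where
  "finite_graph G \<longleftrightarrow>
     finite (verts G) \<and> (\<forall>e\<in>edges G. e \<subseteq> verts G \<and> card e = 2)"

definition subgraph :: "'a ugraph \<Rightarrow> 'a ugraph \<Rightarrow> bool" where
  "subgraph H G \<longleftrightarrow> finite_graph H \<and> verts H \<subseteq> verts G \<and> edges H \<subseteq> edges G"

fun path_edges :: "'a list \<Rightarrow> 'a set list" where
  "path_edges (x # y # zs) = {x, y} # path_edges (y # zs)"
| "path_edges _ = []"

definition path_between :: "'a ugraph \<Rightarrow> 'a \<Rightarrow> 'a \<Rightarrow> 'a list \<Rightarrow> bool" where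
  "path_between G u v p \<longleftrightarrow>
     p \<noteq> [] \<and> hd p = u \<and> last p = v \<and> distinct p \<and>
     set p \<subseteq> verts G \<and> set (path_edges p) \<subseteq> edges G"

definition path_length :: "('a set \<Rightarrow> real) \<Rightarrow> 'a list \<Rightarrow> real" where
  "path_length c p = (\<Sum>e\<leftarrow>path_edges p. c e)"

(* The infimum is attained whenever a path exists, since a finite graph has finitely many
   paths; it is \<infinity> when u and v are not connected in G (or are not vertices of G). *)
definition graph_dist :: "('a set \<Rightarrow> real) \<Rightarrow> 'a ugraph \<Rightarrow> 'a \<Rightarrow> 'a \<Rightarrow> ereal" where
  "graph_dist c G u v = (INF p\<in>{p. path_between G u v p}. ereal (path_length c p))"

definition subsetwise_spanner ::
  "'a ugraph \<Rightarrow> ('a set \<Rightarrow> real) \<Rightarrow> real \<Rightarrow> 'a set \<Rightarrow> 'a ugraph \<Rightarrow> bool" where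
  "subsetwise_spanner G c t S H \<longleftrightarrow>
     subgraph H G \<and>
     (\<forall>u\<in>S. \<forall>v\<in>S. graph_dist c H u v \<le> ereal t * graph_dist c G u v)"

definition graph_cost :: "('a set \<Rightarrow> real) \<Rightarrow> 'a ugraph \<Rightarrow> real" where
  "graph_cost c H = (\<Sum>e\<in>edges H. c e)"

definition min_cost_spanner ::
  "'a ugraph \<Rightarrow> ('a set \<Rightarrow> real) \<Rightarrow> real \<Rightarrow> 'a set \<Rightarrow> 'a ugraph \<Rightarrow> bool" where
  "min_cost_spanner G c t S H \<longleftrightarrow> is_arg_min (graph_cost c) (subsetwise_spanner G c t S) H"

(* Levels are numbered 1, ..., l; the values of T and Gs at other indices are irrelevant. *)
definition mlgs_feasible ::
  "'a ugraph \<Rightarrow> ('a set \<Rightarrow> real) \<Rightarrow> real \<Rightarrow> nat \<Rightarrow> (nat \<Rightarrow> 'a set) \<Rightarrow> (nat \<Rightarrow> 'a ugraph) \<Rightarrow> bool" where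
  "mlgs_feasible G c t l T Gs \<longleftrightarrow>
     (\<forall>i\<in>{1..<l}. subgraph (Gs (Suc i)) (Gs i)) \<and>
     (\<forall>i\<in>{1..l}. subsetwise_spanner G c t (T i) (Gs i))"

definition mlgs_cost :: "('a set \<Rightarrow> real) \<Rightarrow> nat \<Rightarrow> (nat \<Rightarrow> 'a ugraph) \<Rightarrow> real" where
  "mlgs_cost c l Gs = (\<Sum>i=1..l. graph_cost c (Gs i))"

definition mlgs_optimal ::
  "'a ugraph \<Rightarrow> ('a set \<Rightarrow> real) \<Rightarrow> real \<Rightarrow> nat \<Rightarrow> (nat \<Rightarrow> 'a set) \<Rightarrow> (nat \<Rightarrow> 'a ugraph) \<Rightarrow> bool" where
  "mlgs_optimal G c t l T Gs \<longleftrightarrow> is_arg_min (mlgs_cost c l) (mlgs_feasible G c t l T) Gs"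

(* The possible outputs of the oracle bottom-up algorithm, given the spanner H computed for
   level 1. The pruning rule is left open: any nested choice of subgraphs of H that keeps
   the spanner property on every level is allowed. Copying H to every level is the case in
   which nothing is pruned, see bottom_up_output_copy. *)
definition bottom_up_output ::
  "'a ugraph \<Rightarrow> ('a set \<Rightarrow> real) \<Rightarrow> real \<Rightarrow> nat \<Rightarrow> (nat \<Rightarrow> 'a set) \<Rightarrow> 'a ugraph \<Rightarrow>
   (nat \<Rightarrow> 'a ugraph) \<Rightarrow> bool" where
  "bottom_up_output G c t l T H Gs \<longleftrightarrow>
     Gs 1 = H \<and>
     (\<forall>i\<in>{1..<l}. subgraph (Gs (Suc i)) (Gs i)) \<and>
     (\<forall>i\<in>{1..l}. subsetwise_spanner G c t (T i) (Gs i))"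

lemma bottom_up_output_copy:
  assumes nested: "\<And>i. \<lbrakk>1 \<le> i; i < l\<rbrakk> \<Longrightarrow> T (Suc i) \<subseteq> T i"
    and H: "subsetwise_spanner G c t (T 1) H"
  shows "bottom_up_output G c t l T H (\<lambda>_. H)"
proof -
  have "T i \<subseteq> T 1" if "1 \<le> i" "i \<le> l" for i
    using that
  proof (induction i rule: dec_induct)
    case (step i)
    then show ?case using nested[of i] by auto
  qed simp
  then have "subsetwise_spanner G c t (T i) H" if "i \<in> {1..l}" for i
    using that H unfolding subsetwise_spanner_def by (meson atLeastAtMost_iff subsetD)
  moreover have "subgraph H H"
    using H by (simp add: subsetwise_spanner_def subgraph_def)
  ultimately show ?thesis
    by (simp add: bottom_up_output_def)
qed

end

theory Submission imports Defs begin

text \<open>Pruning never makes a level more expensive than \<open>H\<close>: weights are positive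
  and every \<open>Gs i\<close> lies inside \<open>H\<close> (\<open>graph_cost_mono\<close>). On
  the other side, level 1 of an optimal solution is itself a spanner for \<open>T 1\<close>, so it
  competes with \<open>H\<close> and costs at least as much; the remaining optimal levels only add
  nonnegative cost (\<open>graph_cost_nonneg\<close>). So each of the \<open>l\<close> output levels
  costs at most OPT, which gives the factor \<open>l\<close>.\<close>

lemma finite_edges:
  assumes "finite_graph G"
  shows "finite (edges G)"
proof (rule finite_subset)
  show "edges G \<subseteq> Pow (verts G)"
    using assms by (auto simp: finite_graph_def)
  show "finite (Pow (verts G))"
    using assms by (simp add: finite_graph_def)
qed

lemma graph_cost_mono:
  assumes "subgraph H K" "subgraph K G" and "\<And>e. e \<in> edges G \<Longrightarrow> c e > 0"
  shows "graph_cost c H \<le> graph_cost c K"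
  unfolding graph_cost_def
proof (rule sum_mono2)
  \<comment> \<open>A sum over an infinite set is 0 by convention, so monotonicity needs finiteness
    of the larger edge set.\<close>
  show "finite (edges K)"
    using assms(2) by (simp add: subgraph_def finite_edges)
  show "edges H \<subseteq> edges K"
    using assms(1) by (simp add: subgraph_def)
  show "0 \<le> c e" if "e \<in> edges K - edges H" for e
    using that assms(2) by (auto simp: subgraph_def intro!: less_imp_le assms(3))
qed

lemma graph_cost_nonneg:
  assumes "subgraph K G" and "\<And>e. e \<in> edges G \<Longrightarrow> c e > 0"
  shows "0 \<le> graph_cost c K"
  unfolding graph_cost_def
  using assms(1) by (intro sum_nonneg less_imp_le assms(2)) (auto simp: subgraph_def)

theorem theorem1:
  fixes G H :: "'a ugraph" and c :: "'a set \<Rightarrow> real" and t :: real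
    and l :: nat and T :: "nat \<Rightarrow> 'a set" and Gs Gopt :: "nat \<Rightarrow> 'a ugraph"
  assumes "finite_graph G"
    and "\<And>e. e \<in> edges G \<Longrightarrow> c e > 0"
    and "t \<ge> 1"
    and "l \<ge> 1"
    and "T 1 \<subseteq> verts G"
    and "\<And>i. \<lbrakk>1 \<le> i; i < l\<rbrakk> \<Longrightarrow> T (Suc i) \<subseteq> T i"
    and "min_cost_spanner G c t (T 1) H"
    and "bottom_up_output G c t l T H Gs"
    and "mlgs_optimal G c t l T Gopt"
  shows "mlgs_cost c l Gs \<le> real l * mlgs_cost c l Gopt"
proof -
  have Gs1: "Gs 1 = H"
    and nested: "\<And>i. i \<in> {1..<l} \<Longrightarrow> subgraph (Gs (Suc i)) (Gs i)"
    and sub: "\<And>i. i \<in> {1..l} \<Longrightarrow> subgraph (Gs i) G"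
    using assms(8) by (auto simp: bottom_up_output_def subsetwise_spanner_def)
  have "mlgs_feasible G c t l T Gopt"
    using assms(9) by (simp add: mlgs_optimal_def is_arg_min_def)
  then have span: "subsetwise_spanner G c t (T i) (Gopt i)" if "i \<in> {1..l}" for i
    using that by (simp add: mlgs_feasible_def)

  \<comment> \<open>Nesting is given only between adjacent levels, so the bound is carried upwards
    from \<open>Gs 1 = H\<close>.\<close>
  have level: "graph_cost c (Gs i) \<le> graph_cost c H" if "1 \<le> i" "i \<le> l" for i
    using that
  proof (induction i rule: dec_induct)
    case base
    then show ?case by (simp add: Gs1[simplified])
  next
    case (step i)
    have "graph_cost c (Gs (Suc i)) \<le> graph_cost c (Gs i)"
      using step.hyps step.prems by (intro graph_cost_mono[OF nested sub assms(2)]) auto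
    then show ?case using step by simp
  qed

  \<comment> \<open>Minimality of \<open>H\<close> is tested against \<open>Gopt 1\<close>; level 1
    exists because \<open>l\<close> is at least 1.\<close>
  have "graph_cost c H \<le> graph_cost c (Gopt 1)"
    using assms(7) span[of 1] \<open>l \<ge> 1\<close>
    by (auto simp: min_cost_spanner_def is_arg_min_linorder)
  also have "\<dots> \<le> mlgs_cost c l Gopt"
    unfolding mlgs_cost_def
  proof (rule member_le_sum)
    show "0 \<le> graph_cost c (Gopt i)" if "i \<in> {1..l} - {1}" for i
      using that span[of i]
      by (intro graph_cost_nonneg[OF _ assms(2)]) (auto simp: subsetwise_spanner_def)
  qed (use \<open>l \<ge> 1\<close> in auto)
  finally have "graph_cost c H \<le> mlgs_cost c l Gopt" .
  then have "graph_cost c (Gs i) \<le> mlgs_cost c l Gopt" if "i \<in> {1..l}" for i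
    using level[of i] that by simp
  \<comment> \<open>Each level is charged separately against the entire optimum.\<close>
  then have "mlgs_cost c l Gs \<le> (\<Sum>i=1..l. mlgs_cost c l Gopt)"
    unfolding mlgs_cost_def[of c l Gs] by (rule sum_mono)
  then show ?thesis by simp
qed

end
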